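(* For all integers $n,m\ge 1$, the collection $(\mathbb R^n,\mathbb R^m,(\mathbb R^n\times\mathbb R^m,\gamma))$ is not a Lebesgue triple, where $\gamma$ denotes the cross-topology on $\mathbb R^n\times\mathbb R^m$.
   Context: Cross-topology: for topological spaces $X$ and $Y$, $\gamma$ is the collection of all subsets $A$ of $X\times Y$ such that for every point $(x,y)\in A$ there exist neighborhoods $U$ of $x$ in $X$ and $V$ of $y$ in $Y$ with $(\{x\}\times V)\cup(U\times\{y\})\subseteq A$. This is a topology on $X\times Y$, called the cross-topology; $(X\times Y,\gamma)$ denotes $X\times Y$ with this topology, while $X\times Y$ alone carries the product topology. A mapping $f:X\times Y\to Z$ between topological spaces is separately continuous if for every $x\in X$ the mapping $y\mapsto f(x,y)$ is continuous on $Y$ and for every $y\in Y$ the mapping $x\mapsto f(x,y)$ is continuous on $X$. A mapping $f:S\to T$ between topological spaces belongs to the first Baire class if there is a sequence of continuous mappings $f_n:S\to T$ with $f_n(s)\to f(s)$ in $T$ for every $s\in S$. A collection $(X,Y,Z)$ of topological spaces is a Lebesgue triple if every separately continuous mapping $f:X\times Y\to Z$ belongs to the first Baire class (with $X\times Y$ carrying the product topology). *)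

theory Defs
  imports "HOL-Analysis.Analysis"
begin

definition cross_open :: "'a topology \<Rightarrow> 'b topology \<Rightarrow> ('a \<times> 'b) set \<Rightarrow> bool" where
  "cross_open X Y A \<longleftrightarrow>
     A \<subseteq> topspace X \<times> topspace Y \<and>
     (\<forall>(x, y) \<in> A. \<exists>U V. openin X U \<and> x \<in> U \<and> openin Y V \<and> y \<in> V \<and>
        ({x} \<times> V) \<union> (U \<times> {y}) \<subseteq> A)"

definition cross_topology :: "'a topology \<Rightarrow> 'b topology \<Rightarrow> ('a \<times> 'b) topology" where
  "cross_topology X Y = topology (cross_open X Y)"

lemma cross_openE:
  assumes "cross_open X Y A" "(x, y) \<in> A"
  obtains U V where "openin X U" "x \<in> U" "openin Y V" "y \<in> V"
    "({x} \<times> V) \<union> (U \<times> {y}) \<subseteq> A"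
  using assms unfolding cross_open_def by fast

lemma istopology_cross_open: "istopology (cross_open X Y)"
  unfolding istopology_def
proof (intro conjI allI impI)
  fix A B assume A: "cross_open X Y A" and B: "cross_open X Y B"
  show "cross_open X Y (A \<inter> B)"
    unfolding cross_open_def
  proof (intro conjI ballI, goal_cases)
    case 1
    show ?case using A by (auto simp: cross_open_def)
  next
    case (2 p)
    obtain x y where p: "p = (x, y)" by (cases p)
    with 2 have "(x, y) \<in> A" "(x, y) \<in> B" by auto
    obtain U V where UV: "openin X U" "x \<in> U" "openin Y V" "y \<in> V"
      "({x} \<times> V) \<union> (U \<times> {y}) \<subseteq> A"
      using cross_openE[OF A \<open>(x, y) \<in> A\<close>] .
    obtain U' V' where UV': "openin X U'" "x \<in> U'" "openin Y V'" "y \<in> V'"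
      "({x} \<times> V') \<union> (U' \<times> {y}) \<subseteq> B"
      using cross_openE[OF B \<open>(x, y) \<in> B\<close>] .
    have "openin X (U \<inter> U') \<and> x \<in> U \<inter> U' \<and> openin Y (V \<inter> V') \<and> y \<in> V \<inter> V' \<and>
        ({x} \<times> (V \<inter> V')) \<union> ((U \<inter> U') \<times> {y}) \<subseteq> A \<inter> B"
      using UV UV' by blast
    then show ?case unfolding p by blast
  qed
next
  fix \<A> assume *: "\<forall>A\<in>\<A>. cross_open X Y A"
  show "cross_open X Y (\<Union>\<A>)"
    unfolding cross_open_def
  proof (intro conjI ballI, goal_cases)
    case 1
    show ?case using * by (auto simp: cross_open_def)
  next
    case (2 p)
    obtain x y where p: "p = (x, y)" by (cases p)
    with 2 obtain A where A: "A \<in> \<A>" "(x, y) \<in> A" by auto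
    with * have "cross_open X Y A" by blast
    then obtain U V where "openin X U" "x \<in> U" "openin Y V" "y \<in> V"
      "({x} \<times> V) \<union> (U \<times> {y}) \<subseteq> A"
      using cross_openE A(2) by metis
    then show ?case using A(1) unfolding p by blast
  qed
qed

lemma openin_cross_topology [simp]: "openin (cross_topology X Y) = cross_open X Y"
  by (simp add: cross_topology_def istopology_cross_open topology_inverse')

lemma topspace_cross_topology [simp]:
  "topspace (cross_topology X Y) = topspace X \<times> topspace Y"
proof -
  have "cross_open X Y (topspace X \<times> topspace Y)"
    unfolding cross_open_def using openin_topspace by fast
  then have "topspace X \<times> topspace Y \<subseteq> topspace (cross_topology X Y)"
    by (intro openin_subset) simp
  moreover have "cross_open X Y (topspace (cross_topology X Y))"
    using openin_topspace[of "cross_topology X Y"] by simp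
  then have "topspace (cross_topology X Y) \<subseteq> topspace X \<times> topspace Y"
    unfolding cross_open_def by blast
  ultimately show ?thesis by blast
qed

definition separately_continuous ::
    "'a topology \<Rightarrow> 'b topology \<Rightarrow> 'c topology \<Rightarrow> ('a \<times> 'b \<Rightarrow> 'c) \<Rightarrow> bool" where
  "separately_continuous X Y Z f \<longleftrightarrow>
     (\<forall>x \<in> topspace X. continuous_map Y Z (\<lambda>y. f (x, y))) \<and>
     (\<forall>y \<in> topspace Y. continuous_map X Z (\<lambda>x. f (x, y)))"

definition first_Baire_class :: "'a topology \<Rightarrow> 'b topology \<Rightarrow> ('a \<Rightarrow> 'b) \<Rightarrow> bool" where
  "first_Baire_class S T f \<longleftrightarrow>
     (\<exists>F :: nat \<Rightarrow> 'a \<Rightarrow> 'b. (\<forall>n. continuous_map S T (F n)) \<and>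
        (\<forall>s \<in> topspace S. limitin T (\<lambda>n. F n s) (f s) sequentially))"

definition Lebesgue_triple :: "'a topology \<Rightarrow> 'b topology \<Rightarrow> 'c topology \<Rightarrow> bool" where
  "Lebesgue_triple X Y Z \<longleftrightarrow>
     (\<forall>f. separately_continuous X Y Z f \<longrightarrow> first_Baire_class (prod_topology X Y) Z f)"

end

theory Submission
  imports Defs
begin

text \<open>
  The identity into the cross-topology is separately continuous. Suppose continuous maps \<open>F\<^sub>n\<close>
  converge to it pointwise. A set meeting every horizontal and vertical line in at most one point is
  discrete and closed in the cross-topology; hence cross-compact sets lie in finitely many lines, and
  a cross-convergent sequence eventually stays in the cross through its limit. By Baire there are
  a ball \<open>B\<close> and an \<open>N\<close> such that \<open>F\<^sub>n p\<close> lies in the cross through \<open>p\<close> for all \<open>p \<in> B\<close>, \<open>n \<ge> N\<close>.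
  Since \<open>F\<^sub>n B\<close> lies in finitely many lines and \<open>B\<close> remains connected after removing finitely many
  points, one of the two coordinates of \<open>F\<^sub>n\<close> is constant on \<open>B\<close>. This contradicts convergence at two
  points of \<open>B\<close> that differ in both coordinates.
\<close>

section \<open>Comparison with the product topology\<close>

abbreviation cross_euclidean :: "('a::topological_space \<times> 'b::topological_space) topology" where
  "cross_euclidean \<equiv> cross_topology euclidean euclidean"

lemma cross_open_if_open:
  fixes A :: "('a::topological_space \<times> 'b::topological_space) set"
  assumes "open A"
  shows "cross_open euclidean euclidean A"
  unfolding cross_open_def
proof (intro conjI ballI)
  fix p assume "p \<in> A"
  then obtain U V where "open U" "open V" "p \<in> U \<times> V" "U \<times> V \<subseteq> A"
    using open_prod_elim[OF assms] by metis
  then show "case p of (x, y) \<Rightarrow> \<exists>U V. openin euclidean U \<and> x \<in> U \<and> openin euclidean V \<and>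
      y \<in> V \<and> ({x} \<times> V) \<union> (U \<times> {y}) \<subseteq> A"
    by (cases p) (simp, blast)
qed simp

text \<open>The cross-topology refines the product topology; composing with this map carries
  continuity and limits over to the usual topology.\<close>

lemma continuous_map_cross_euclidean_id: "continuous_map cross_euclidean euclidean id"
  by (simp add: continuous_map_def cross_open_if_open)

lemma separately_continuous_id: "separately_continuous X Y (cross_topology X Y) id"
proof -
  have "openin Y {y \<in> topspace Y. (x, y) \<in> A}" if A: "cross_open X Y A" for x A
  proof (subst openin_subopen, intro ballI)
    fix y assume "y \<in> {y \<in> topspace Y. (x, y) \<in> A}"
    then have "(x, y) \<in> A" by simp
    obtain U V where "openin X U" "x \<in> U" "openin Y V" "y \<in> V"
      "({x} \<times> V) \<union> (U \<times> {y}) \<subseteq> A"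
      by (rule cross_openE[OF A \<open>(x, y) \<in> A\<close>])
    then show "\<exists>T. openin Y T \<and> y \<in> T \<and> T \<subseteq> {y \<in> topspace Y. (x, y) \<in> A}"
      by (auto intro!: exI[of _ V] dest: openin_subset)
  qed
  moreover have "openin X {x \<in> topspace X. (x, y) \<in> A}" if A: "cross_open X Y A" for y A
  proof (subst openin_subopen, intro ballI)
    fix x assume "x \<in> {x \<in> topspace X. (x, y) \<in> A}"
    then have "(x, y) \<in> A" by simp
    obtain U V where "openin X U" "x \<in> U" "openin Y V" "y \<in> V"
      "({x} \<times> V) \<union> (U \<times> {y}) \<subseteq> A"
      by (rule cross_openE[OF A \<open>(x, y) \<in> A\<close>])
    then show "\<exists>T. openin X T \<and> x \<in> T \<and> T \<subseteq> {x \<in> topspace X. (x, y) \<in> A}"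
      by (auto intro!: exI[of _ U] dest: openin_subset)
  qed
  ultimately show ?thesis
    by (auto simp: separately_continuous_def continuous_map_def)
qed

section \<open>Compact sets and convergent sequences in the cross-topology\<close>

lemma cross_open_Compl_if_inj_on:
  fixes D :: "('a::t1_space \<times> 'b::t1_space) set"
  assumes fst: "inj_on fst D" and snd: "inj_on snd D"
  shows "cross_open euclidean euclidean (- D)"
  unfolding cross_open_def
proof (intro conjI ballI)
  fix p assume p: "p \<in> - D"
  \<comment> \<open>\<open>D\<close> meets every line at most once, so \<open>U\<close> and
    \<open>V\<close> each omit at most one point and are open by T1. As \<open>p\<close> is not in
    \<open>D\<close>, no coordinate of \<open>p\<close> is omitted.\<close>
  define U where "U = - fst ` {q \<in> D. snd q = snd p}"
  define V where "V = - snd ` {q \<in> D. fst q = fst p}"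
  have fin: "finite {q \<in> D. h q = c}" if "inj_on h D" for h :: "_ \<Rightarrow> 'c" and c
    using finite_vimage_IntI[OF _ that, of "{c}"] by (simp add: vimage_def Int_def conj_commute)
  have "open U" "open V"
    unfolding U_def V_def by (intro open_Compl finite_imp_closed finite_imageI fin fst snd)+
  moreover have "fst p \<in> U" "snd p \<in> V" "({fst p} \<times> V) \<union> (U \<times> {snd p}) \<subseteq> - D"
    using p unfolding U_def V_def by (force simp: prod_eq_iff)+
  ultimately show "case p of (x, y) \<Rightarrow> \<exists>U V. openin euclidean U \<and> x \<in> U \<and>
      openin euclidean V \<and> y \<in> V \<and> ({x} \<times> V) \<union> (U \<times> {y}) \<subseteq> - D"
    by (cases p) (auto intro!: exI[of _ U] exI[of _ V])
qed simp

text \<open>Subsets of \<open>D\<close> inherit injectivity of both projections and so are closed;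
  an infinite \<open>D\<close> would thus lack the accumulation point that compactness
  forces.\<close>

lemma finite_if_inj_on_compactin_cross:
  fixes D :: "('a::t1_space \<times> 'b::t1_space) set"
  assumes K: "compactin cross_euclidean K" and D: "D \<subseteq> K" "inj_on fst D" "inj_on snd D"
  shows "finite D"
proof (rule ccontr)
  assume "infinite D"
  then obtain p where p: "p \<in> cross_euclidean derived_set_of D"
    using compactin_imp_Bolzano_Weierstrass[OF K] D(1) by blast
  have "cross_open euclidean euclidean (- (D - {p}))"
    using D(2,3) by (intro cross_open_Compl_if_inj_on) (auto intro: inj_on_diff)
  then show False
    using p unfolding in_derived_set_of by (auto dest!: spec[of _ "- (D - {p})"])
qed

text \<open>A maximal subset of \<open>K\<close> on which both projections are injective is finite,
  and by maximality every point of \<open>K\<close> shares a coordinate with one of its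
  points.\<close>

lemma compactin_cross_finite_lines:
  fixes K :: "('a::t1_space \<times> 'b::t1_space) set"
  assumes K: "compactin cross_euclidean K"
  obtains X Y where "finite X" "finite Y" "K \<subseteq> X \<times> UNIV \<union> UNIV \<times> Y"
proof -
  define \<D> where "\<D> = {D. D \<subseteq> K \<and> inj_on fst D \<and> inj_on snd D}"
  have "\<exists>M\<in>\<D>. \<forall>D\<in>\<D>. M \<subseteq> D \<longrightarrow> D = M"
  proof (rule subset_Zorn')
    fix \<C> assume \<C>: "subset.chain \<D> \<C>"
    have "inj_on h (\<Union>D\<in>\<C>. D)" if "\<And>D. D \<in> \<D> \<Longrightarrow> inj_on h D" for h :: "_ \<Rightarrow> 'c"
      by (rule inj_on_UNION_chain) (use \<C> that in \<open>auto simp: subset_chain_def\<close>)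
    from this[of fst] this[of snd] show "\<Union>\<C> \<in> \<D>"
      using \<C> by (auto simp: \<D>_def subset_chain_def)
  qed
  then obtain M where M: "M \<in> \<D>" and max: "\<And>D. D \<in> \<D> \<Longrightarrow> M \<subseteq> D \<Longrightarrow> D = M"
    by blast
  have "finite M"
    using finite_if_inj_on_compactin_cross[OF K] M by (auto simp: \<D>_def)
  moreover have "p \<in> fst ` M \<times> UNIV \<union> UNIV \<times> snd ` M" if "p \<in> K" for p
  proof (rule ccontr)
    assume "p \<notin> fst ` M \<times> UNIV \<union> UNIV \<times> snd ` M"
    then have p: "fst p \<notin> fst ` M" "snd p \<notin> snd ` M"
      unfolding Un_iff mem_Times_iff by blast+
    then have "p \<notin> M"
      by blast
    with p have "insert p M \<in> \<D>"
      using M that by (simp add: \<D>_def)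
    then show False
      using max[of "insert p M"] \<open>p \<notin> M\<close> by blast
  qed
  ultimately show thesis
    by (intro that[of "fst ` M" "snd ` M"]) auto
qed

text \<open>The terms off the cross through \<open>p\<close> can accumulate only at \<open>p\<close>
  in the usual topology, and the cross through \<open>p\<close> misses them. Hence their complement
  is a cross-neighbourhood of \<open>p\<close>.\<close>

lemma eventually_in_cross:
  fixes s :: "nat \<Rightarrow> 'a::t2_space \<times> 'b::t2_space"
  assumes s: "limitin cross_euclidean s p sequentially"
  shows "\<forall>\<^sub>F n in sequentially. fst (s n) = fst p \<or> snd (s n) = snd p"
proof -
  define E where "E = {q \<in> range s. fst q \<noteq> fst p \<and> snd q \<noteq> snd p}"
  have E: "fst q \<noteq> fst p" "snd q \<noteq> snd p" if "q \<in> E" for q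
    using that by (auto simp: E_def)
  have lim: "s \<longlonglongrightarrow> p"
    using continuous_map_limit[OF continuous_map_cross_euclidean_id s] by simp
  have "open (- insert p E)"
  proof (subst open_subopen, intro ballI)
    fix q assume q: "q \<in> - insert p E"
    then obtain U V where UV: "open U" "open V" "p \<in> U" "q \<in> V" "U \<inter> V = {}"
      using hausdorff[of p q] by auto
    obtain N where N: "\<And>n. n \<ge> N \<Longrightarrow> s n \<in> U"
      using topological_tendstoD[OF lim UV(1,3)] by (auto simp: eventually_sequentially)
    \<comment> \<open>Only finitely many terms lie outside \<open>U\<close>, so removing
      \<open>E\<close> from \<open>V\<close> removes a finite set and keeps it open.\<close>
    have "E \<inter> V \<subseteq> s ` {..<N}"
    proof
      fix r assume "r \<in> E \<inter> V"
      then obtain n where "r = s n" "s n \<notin> U"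
        using UV(5) by (auto simp: E_def)
      then show "r \<in> s ` {..<N}"
        using N[of n] by (cases "n < N") auto
    qed
    then have "open (V - E \<inter> V)"
      by (intro open_Diff UV finite_imp_closed) (auto intro: finite_subset)
    then show "\<exists>T. open T \<and> q \<in> T \<and> T \<subseteq> - insert p E"
      using q UV by (intro exI[of _ "V - E \<inter> V - {p}"]) auto
  qed
  then have *: "cross_open euclidean euclidean (- insert p E)"
    by (rule cross_open_if_open)
  have "cross_open euclidean euclidean (- E)"
    unfolding cross_open_def
  proof (intro conjI ballI)
    fix q assume "q \<in> - E"
    show "case q of (x, y) \<Rightarrow> \<exists>U V. openin euclidean U \<and> x \<in> U \<and> openin euclidean V \<and>
        y \<in> V \<and> ({x} \<times> V) \<union> (U \<times> {y}) \<subseteq> - E"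
    proof (cases "q = p")
      \<comment> \<open>Both full lines through \<open>p\<close> avoid \<open>E\<close>, so
        \<open>UNIV\<close> serves as both neighbourhoods.\<close>
      case True
      then show ?thesis
        using E by (cases p) (fastforce intro!: exI[of _ UNIV])
    next
      case False
      obtain x y where xy: "q = (x, y)"
        by (cases q)
      have "(x, y) \<in> - insert p E"
        using False \<open>q \<in> - E\<close> xy by blast
      then obtain U V where "openin euclidean U" "x \<in> U" "openin euclidean V" "y \<in> V"
        "({x} \<times> V) \<union> (U \<times> {y}) \<subseteq> - insert p E"
        using cross_openE[OF *] by metis
      then show ?thesis
        unfolding xy prod.case by blast
    qed
  qed simp
  then have "\<forall>\<^sub>F n in sequentially. s n \<in> - E"
    using s by (auto simp: limitin_def E_def)
  then show ?thesis
    by eventually_elim (auto simp: E_def)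
qed

section \<open>Maps that move points within their crosses and into finitely many lines\<close>

lemma interior_finite_lines:
  fixes X :: "'a::{real_normed_vector,perfect_space} set"
    and Y :: "'b::{real_normed_vector,perfect_space} set"
  assumes "finite X" "finite Y"
  shows "interior (X \<times> UNIV \<union> UNIV \<times> Y) = {}"
proof -
  have "closed (X \<times> (UNIV :: 'b set))"
    using assms by (intro closed_Times finite_imp_closed closed_UNIV)
  moreover have "interior ((UNIV :: 'a set) \<times> Y) = {}" "interior (X \<times> (UNIV :: 'b set)) = {}"
    using assms by (simp_all add: interior_Times empty_interior_finite)
  ultimately show ?thesis
    using interior_closed_Un_empty_interior by metis
qed

text \<open>\<open>S - C\<close> is open and contained in \<open>W\<close>. This extends closed
  conditions across exceptional sets without interior.\<close>

lemma subset_closed_if_interior_empty: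
  assumes "open S" "closed C" "interior W = {}" "S - W \<subseteq> C"
  shows "S \<subseteq> C"
proof -
  have "S - C \<subseteq> interior W"
    using assms by (intro interior_maximal) auto
  with assms(3) show ?thesis by blast
qed

lemma constant_coordinate:
  fixes f :: "'a::euclidean_space \<times> 'b::euclidean_space \<Rightarrow> 'a \<times> 'b"
  assumes S: "open S" "connected S" and f: "continuous_on UNIV f"
    and cross: "\<And>p. p \<in> S \<Longrightarrow> fst (f p) = fst p \<or> snd (f p) = snd p"
    and XY: "finite X" "finite Y" and lines: "f ` S \<subseteq> X \<times> UNIV \<union> UNIV \<times> Y"
  shows "(\<forall>p\<in>S. \<forall>q\<in>S. fst (f p) = fst (f q)) \<or> (\<forall>p\<in>S. \<forall>q\<in>S. snd (f p) = snd (f q))"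
proof -
  define M where "M = S - X \<times> Y"
  define P where "P = {p. fst (f p) = fst p \<and> snd (f p) \<in> Y}"
  define Q where "Q = {p. snd (f p) = snd p \<and> fst (f p) \<in> X}"
  \<comment> \<open>Dimension at least 2 keeps a connected open set connected after deleting
    finitely many points.\<close>
  have dim: "DIM('a \<times> 'b) \<ge> 2"
    using DIM_positive[where 'a='a] DIM_positive[where 'a='b] by (simp del: DIM_positive)
  have fin: "finite (X \<times> Y)"
    using XY by simp
  have conn: "connected M"
    unfolding M_def using S dim fin by (intro connected_open_diff_countable) (auto intro: countable_finite)
  have cont: "continuous_on A (\<lambda>p. fst (f p))" "continuous_on A (\<lambda>p. snd (f p))" for A
    using f by (auto intro!: continuous_intros intro: continuous_on_subset)
  have closed: "closed P" "closed Q"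
    unfolding P_def Q_def Collect_conj_eq
    using closed_vimage[OF finite_imp_closed cont(2), of Y] closed_vimage[OF finite_imp_closed cont(1), of X] XY
    by (intro closed_Int closed_Collect_eq cont continuous_on_fst continuous_on_snd continuous_on_id;
        simp add: vimage_def)+
  \<comment> \<open>Off the lines over \<open>X\<close> and \<open>Y\<close>, a coordinate kept by
    \<open>f\<close> avoids its finite set, so the other coordinate of \<open>f p\<close> must lie
    in its own. Closedness of \<open>P \<union> Q\<close> then covers the rest of
    \<open>S\<close>.\<close>
  have sub: "S \<subseteq> P \<union> Q"
  proof (rule subset_closed_if_interior_empty)
    show "S - (X \<times> UNIV \<union> UNIV \<times> Y) \<subseteq> P \<union> Q"
      using lines cross by (force simp: P_def Q_def mem_Times_iff image_subset_iff)
  qed (use S closed XY in \<open>auto simp: interior_finite_lines\<close>)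
  \<comment> \<open>A point of \<open>P\<close> and \<open>Q\<close> is fixed by \<open>f\<close>
    and has coordinates in \<open>X\<close> and \<open>Y\<close>, so it was deleted from
    \<open>M\<close>.\<close>
  have "P \<inter> Q \<inter> M = {}"
    by (auto simp: P_def Q_def M_def mem_Times_iff)
  then have "P \<inter> M = {} \<or> Q \<inter> M = {}"
    using connected_closedD[OF conn _ _ closed] sub by (auto simp: M_def)
  then have *: "M \<subseteq> P \<or> M \<subseteq> Q"
    using sub by (auto simp: M_def)
  \<comment> \<open>A continuous map with finitely many values on the connected set \<open>M\<close>
    is constant there; its closed fibre also contains the deleted points.\<close>
  have const: "\<forall>p\<in>S. \<forall>q\<in>S. h p = h q"
    if h: "continuous_on UNIV h" and "h ` M \<subseteq> C" "finite C"
    for h :: "'a \<times> 'b \<Rightarrow> 'c::metric_space" and C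
  proof -
    have "connected (h ` M)" "finite (h ` M)"
      using that conn by (auto intro: connected_continuous_image continuous_on_subset finite_subset)
    then obtain c where c: "h ` M \<subseteq> {c}"
      using connected_finite_iff_sing[of "h ` M"] by auto
    have "S \<subseteq> h -` {c}"
    proof (rule subset_closed_if_interior_empty[OF S(1)])
      show "closed (h -` {c})"
        by (rule closed_vimage[OF closed_singleton h])
      show "interior (X \<times> Y) = {}"
        by (rule empty_interior_finite[OF fin])
      show "S - X \<times> Y \<subseteq> h -` {c}"
        using c by (fold M_def) (simp add: image_subset_iff_subset_vimage)
    qed
    then have "h p = c" if "p \<in> S" for p
      using that by blast
    then show ?thesis by simp
  qed
  from * show ?thesis
  proof
    assume "M \<subseteq> P"
    then have "(\<lambda>p. snd (f p)) ` M \<subseteq> Y"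
      by (auto simp: P_def)
    from const[OF cont(2) this XY(2)] show ?thesis by blast
  next
    assume "M \<subseteq> Q"
    then have "(\<lambda>p. fst (f p)) ` M \<subseteq> X"
      by (auto simp: Q_def)
    from const[OF cont(1) this XY(1)] show ?thesis by blast
  qed
qed

lemma not_Lebesgue_triple_cross_euclidean:
  "\<not> Lebesgue_triple (euclidean :: 'a::euclidean_space topology)
       (euclidean :: 'b::euclidean_space topology) (cross_euclidean :: ('a \<times> 'b) topology)"
proof
  assume "Lebesgue_triple (euclidean :: 'a topology) (euclidean :: 'b topology)
    (cross_euclidean :: ('a \<times> 'b) topology)"
  then have "first_Baire_class euclidean cross_euclidean (id :: 'a \<times> 'b \<Rightarrow> 'a \<times> 'b)"
    using separately_continuous_id unfolding Lebesgue_triple_def prod_topology_euclidean by blast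
  then obtain F :: "nat \<Rightarrow> 'a \<times> 'b \<Rightarrow> 'a \<times> 'b"
    where F: "\<And>n. continuous_map euclidean cross_euclidean (F n)"
      and lim: "\<forall>p. limitin cross_euclidean (\<lambda>n. F n p) p sequentially"
    unfolding first_Baire_class_def by auto
  have cont: "continuous_on A (F n)" for A n
    using continuous_map_compose[OF F continuous_map_cross_euclidean_id]
    by (auto intro: continuous_on_subset)
  have tends: "(\<lambda>n. F n p) \<longlonglongrightarrow> p" for p
    using continuous_map_limit[OF continuous_map_cross_euclidean_id lim[rule_format]] by (simp add: o_def)

  define A where "A N = {p. \<forall>n\<ge>N. fst (F n p) = fst p \<or> snd (F n p) = snd p}" for N
  have "closed (A N)" for N
    unfolding A_def
    by (intro closed_Collect_all closed_Collect_imp closed_Collect_disj closed_Collect_eq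
        continuous_intros cont) auto
  moreover have "(\<Union>N. A N) = UNIV"
    using eventually_in_cross[OF lim[rule_format]] by (auto simp: A_def eventually_sequentially)
  \<comment> \<open>Countably many closed sets covering a completely metrizable space cannot all
    have empty interior.\<close>
  ultimately obtain N where "interior (A N) \<noteq> {}"
    using Baire_category_alt[of "euclidean :: ('a \<times> 'b) topology" "range A"]
    by (auto simp: completely_metrizable_space_euclidean)
  then obtain p e where e: "e > 0" and A: "ball p e \<subseteq> A N"
    by (auto simp: mem_interior)
  have const: "(\<forall>u\<in>ball p e. \<forall>v\<in>ball p e. fst (F n u) = fst (F n v)) \<or>
      (\<forall>u\<in>ball p e. \<forall>v\<in>ball p e. snd (F n u) = snd (F n v))" if "n \<ge> N" for n
  proof -
    \<comment> \<open>The closed ball supplies compactness, the open ball inside it supplies the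
      open connected set.\<close>
    have "compactin cross_euclidean (F n ` cball p e)"
      using F by (intro image_compactin[of euclidean]) auto
    then obtain X Y where "finite X" "finite Y" "F n ` cball p e \<subseteq> X \<times> UNIV \<union> UNIV \<times> Y"
      by (rule compactin_cross_finite_lines)
    moreover have "F n ` ball p e \<subseteq> F n ` cball p e"
      by (intro image_mono ball_subset_cball)
    ultimately show ?thesis
      using A \<open>n \<ge> N\<close>
      by (intro constant_coordinate[where f = "F n" and X = X and Y = Y] cont) (auto simp: A_def)
  qed
  \<comment> \<open>The two lines through \<open>p\<close> have empty interior, which yields a point
    of the ball differing from \<open>p\<close> in both coordinates.\<close>
  have "\<not> ball p e \<subseteq> {fst p} \<times> UNIV \<union> UNIV \<times> {snd p}"
    using interior_finite_lines[of "{fst p}" "{snd p}"] e interior_maximal[OF _ open_ball]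
    by (metis ball_eq_empty finite.emptyI finite_insert not_le subset_empty)
  then obtain q where q: "q \<in> ball p e" "fst q \<noteq> fst p" "snd q \<noteq> snd p"
    unfolding subset_iff Un_iff mem_Times_iff by blast
  \<comment> \<open>Both coordinates of \<open>p - q\<close> are nonzero, so eventually
    \<open>F n p\<close> and \<open>F n q\<close> differ in both coordinates, while
    \<open>const\<close> makes them agree in one.\<close>
  have diff: "(\<lambda>n. F n p - F n q) \<longlonglongrightarrow> p - q"
    by (intro tendsto_diff tends)
  have "\<forall>\<^sub>F n in sequentially. fst (F n p - F n q) \<noteq> 0"
    using tendsto_imp_eventually_ne[OF tendsto_fst[OF diff], of 0] q by simp
  moreover have "\<forall>\<^sub>F n in sequentially. snd (F n p - F n q) \<noteq> 0"
    using tendsto_imp_eventually_ne[OF tendsto_snd[OF diff], of 0] q by simp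
  moreover have "\<forall>\<^sub>F n in sequentially. n \<ge> N"
    by (rule eventually_ge_at_top)
  ultimately have "\<forall>\<^sub>F n in sequentially. False"
  proof eventually_elim
    case (elim n)
    have "p \<in> ball p e"
      using e by simp
    then have "fst (F n p) = fst (F n q) \<or> snd (F n p) = snd (F n q)"
      using const[OF elim(3)] q(1) by blast
    then show False
      using elim(1,2) by simp
  qed
  then show False by simp
qed

theorem corollary4p4:
  "\<not> Lebesgue_triple (euclidean :: (real ^ 'n) topology) (euclidean :: (real ^ 'm) topology)
       (cross_topology (euclidean :: (real ^ 'n) topology) (euclidean :: (real ^ 'm) topology))"
  by (rule not_Lebesgue_triple_cross_euclidean)

end
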